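(* Let $D$ be a PVMD such that for all nonzero $a_1,\ldots,a_s\in D$ with $(a_1,\ldots,a_s)_v\ne D$, there is an integer $k\ge1$ and a nonunit $d\in D$ such that $(a_1^k,\ldots,a_s^k)\subseteq(d)$. Then $D$ is completely integrally closed if and only if $D$ is Archimedean.
   Context: $D$ is an integral domain with quotient field $K$. For a nonzero fractional ideal $I$ put $I^{-1}=\{x\in K\mid xI\subseteq D\}$, $I_v=(I^{-1})^{-1}$, and $I_t=\bigcup\{J_v\mid J\subseteq I,\ J \text{ a nonzero finitely generated fractional ideal}\}$. $D$ is a PVMD (Prüfer $v$-multiplication domain) if $(II^{-1})_t=D$ for every nonzero finitely generated ideal $I$ of $D$. $D$ is completely integrally closed if whenever $x\in K$ and $0\ne r\in D$ satisfy $rx^n\in D$ for every integer $n\ge1$, then $x\in D$. $D$ is Archimedean if $\bigcap_{n=1}^{\infty}(x^n)=(0)$ for every nonunit $x\in D$. *)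

theory Defs
  imports "HOL-Computational_Algebra.Polynomial_Factorial"
begin

text \<open>
  The domain \<open>D\<close> is the type \<open>'a::idom\<close> and its quotient field \<open>K\<close> is \<open>'a fract\<close>.  All ideals,
  integral or fractional, are represented as subsets of \<open>K\<close>, with \<open>D\<close> identified with its image
  under \<^const>\<open>to_fract\<close>.  Properties of the domain take the type \<open>'a\<close> as an \<open>itself\<close> argument.
\<close>

global_interpretation fract_module: module "\<lambda>(r :: 'a :: idom) (x :: 'a fract). to_fract r * x"
  by unfold_locales (simp_all add: algebra_simps)

abbreviation base_ring :: "'a :: idom fract set"
  where "base_ring \<equiv> range to_fract"

definition fractional_ideal :: "'a :: idom fract set \<Rightarrow> bool"
  where "fractional_ideal I \<longleftrightarrow>
    fract_module.subspace I \<and> (\<exists>r. r \<noteq> 0 \<and> (\<forall>x\<in>I. to_fract r * x \<in> base_ring))"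

definition fg_fractional_ideal :: "'a :: idom fract set \<Rightarrow> bool"
  where "fg_fractional_ideal I \<longleftrightarrow>
    fractional_ideal I \<and> (\<exists>S. finite S \<and> I = fract_module.span S)"

definition ideal_gen :: "'a :: idom set \<Rightarrow> 'a fract set"
  where "ideal_gen A = fract_module.span (to_fract ` A)"

definition ideal_mult :: "'a :: idom fract set \<Rightarrow> 'a fract set \<Rightarrow> 'a fract set"
  where "ideal_mult I J = fract_module.span {x * y | x y. x \<in> I \<and> y \<in> J}"

text \<open>
  The next three operations are meaningful only for nonzero fractional ideals and are applied only
  to those below.
\<close>

definition ideal_inverse :: "'a :: idom fract set \<Rightarrow> 'a fract set"
  where "ideal_inverse I = {x. \<forall>y\<in>I. x * y \<in> base_ring}"

definition v_closure :: "'a :: idom fract set \<Rightarrow> 'a fract set"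
  where "v_closure I = ideal_inverse (ideal_inverse I)"

definition t_closure :: "'a :: idom fract set \<Rightarrow> 'a fract set"
  where "t_closure I = \<Union> {v_closure J | J. J \<subseteq> I \<and> J \<noteq> {0} \<and> fg_fractional_ideal J}"

definition pvmd :: "'a :: idom itself \<Rightarrow> bool"
  where "pvmd _ \<longleftrightarrow>
    (\<forall>I :: 'a fract set. I \<subseteq> base_ring \<and> I \<noteq> {0} \<and> fg_fractional_ideal I \<longrightarrow>
      t_closure (ideal_mult I (ideal_inverse I)) = base_ring)"

definition completely_integrally_closed :: "'a :: idom itself \<Rightarrow> bool"
  where "completely_integrally_closed _ \<longleftrightarrow>
    (\<forall>(x :: 'a fract) r. r \<noteq> 0 \<and> (\<forall>n\<ge>1. to_fract r * x ^ n \<in> base_ring) \<longrightarrow> x \<in> base_ring)"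

definition archimedean_domain :: "'a :: idom itself \<Rightarrow> bool"
  where "archimedean_domain _ \<longleftrightarrow>
    (\<forall>x :: 'a. \<not> x dvd 1 \<longrightarrow> (\<Inter>n\<in>{1..}. ideal_gen {x ^ n}) = {0})"

end

theory Submission
  imports Defs
begin

text \<open>
  Complete integral closure implies the Archimedean property because a nonzero element of
  \<open>\<Inter>(x\<^sup>n)\<close> is a common denominator of all powers of \<open>1/x\<close>.  For the converse, suppose that
  \<open>r z\<^sup>n \<in> D\<close> for all \<open>n \<ge> 1\<close>, with \<open>z = a/b \<notin> D\<close>.  By \<open>t\<close>-invertibility of \<open>(a, b)\<close> there are
  finitely many \<open>c\<^sub>i \<in> (a, b)\<inverse>\<close> such that the elements \<open>a c\<^sub>i, b c\<^sub>i\<close> of \<open>D\<close> together generate an ideal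
  with \<open>v\<close>-closure \<open>D\<close>.  Since \<open>z\<close> lies in the inverse of \<open>(b c\<^sub>1, \<dots>, b c\<^sub>s)\<close>, the \<open>v\<close>-closure of that
  ideal is not \<open>D\<close>, so some nonunit \<open>d\<close> divides every \<open>(b c\<^sub>i)\<^sup>k\<close>.  Then \<open>d\<^sup>m\<close> divides both
  \<open>r (b c\<^sub>i)\<^sup>k\<^sup>m\<close> and \<open>r (a c\<^sub>i)\<^sup>k\<^sup>m = (r z\<^sup>k\<^sup>m) (b c\<^sub>i)\<^sup>k\<^sup>m\<close>.  The \<open>km\<close>-th powers of \<open>a c\<^sub>i, b c\<^sub>i\<close> still generate
  an ideal with \<open>v\<close>-closure \<open>D\<close>, so \<open>d\<^sup>m\<close> divides \<open>r\<close> for every \<open>m\<close>, and \<open>r = 0\<close> if \<open>D\<close> is Archimedean.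
\<close>

section \<open>Membership in the base ring and in principal ideals\<close>

lemma to_fract_power: "to_fract (x ^ n) = to_fract x ^ n"
  by (induction n) simp_all

lemma to_fract_in_ideal_gen_singleton_iff:
  "to_fract x \<in> ideal_gen {d} \<longleftrightarrow> d dvd x"
proof -
  have "to_fract x \<in> ideal_gen {d} \<longleftrightarrow> (\<exists>k. x = k * d)"
    by (auto simp: ideal_gen_def fract_module.span_singleton simp flip: to_fract_mult)
  then show ?thesis by (simp add: dvd_def mult.commute)
qed

lemma base_ring_0: "0 \<in> base_ring"
  using rangeI[of to_fract 0] by simp

lemma base_ring_1: "1 \<in> base_ring"
  using rangeI[of to_fract 1] by simp

lemma base_ring_add: "x \<in> base_ring \<Longrightarrow> y \<in> base_ring \<Longrightarrow> x + y \<in> base_ring"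
  by (auto simp flip: to_fract_add)

lemma base_ring_mult: "x \<in> base_ring \<Longrightarrow> y \<in> base_ring \<Longrightarrow> x * y \<in> base_ring"
  by (auto simp flip: to_fract_mult)

lemma subspace_mult_in_base_ring:
  "fract_module.subspace {x :: 'a :: idom fract. y * x \<in> base_ring}"
proof (rule fract_module.subspaceI)
  show "0 \<in> {x. y * x \<in> base_ring}"
    by (simp add: base_ring_0)
next
  fix u v assume "u \<in> {x. y * x \<in> base_ring}" "v \<in> {x. y * x \<in> base_ring}"
  then show "u + v \<in> {x. y * x \<in> base_ring}"
    by (simp add: base_ring_add distrib_left)
next
  fix c u assume "u \<in> {x. y * x \<in> base_ring}"
  then show "to_fract c * u \<in> {x. y * x \<in> base_ring}"
    using base_ring_mult[of "to_fract c" "y * u"] by (simp add: mult_ac)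
qed

lemma mult_span_in_base_ring:
  assumes "x \<in> fract_module.span S" and "\<And>s. s \<in> S \<Longrightarrow> y * s \<in> base_ring"
  shows "y * x \<in> base_ring"
  using fract_module.span_minimal[OF _ subspace_mult_in_base_ring, of S y] assms by blast

lemma fg_fractional_ideal_span:
  assumes "finite S" and "S \<subseteq> base_ring"
  shows "fg_fractional_ideal (fract_module.span S)"
proof -
  have "1 * x \<in> base_ring" if "x \<in> fract_module.span S" for x
    using that by (rule mult_span_in_base_ring) (use assms in auto)
  then have "\<forall>x\<in>fract_module.span S. to_fract 1 * x \<in> base_ring"
    by simp
  then show ?thesis
    unfolding fg_fractional_ideal_def fractional_ideal_def
    using assms(1) fract_module.subspace_span zero_neq_one by metis
qed

section \<open>Finite sets generating an ideal with v-closure \<open>D\<close>\<close>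

text \<open>
  For \<open>A \<subseteq> D\<close> this says that the ideal generated by \<open>A\<close> has \<open>v\<close>-closure \<open>D\<close>.
\<close>
definition v_unimodular :: "'a :: idom fract set \<Rightarrow> bool"
  where "v_unimodular A \<longleftrightarrow> (\<forall>y. (\<forall>x\<in>A. y * x \<in> base_ring) \<longrightarrow> y \<in> base_ring)"

lemma v_unimodularD:
  "v_unimodular A \<Longrightarrow> (\<And>x. x \<in> A \<Longrightarrow> y * x \<in> base_ring) \<Longrightarrow> y \<in> base_ring"
  by (auto simp: v_unimodular_def)

text \<open>Descent on the exponent: if \<open>y * x ^ Suc j\<close> is in \<open>D\<close>, then
  \<open>y * x ^ j\<close> multiplies \<open>x\<close> and every element of \<open>B\<close> into
  \<open>D\<close>, so unimodularity puts it in \<open>D\<close>. At exponent 0 this gives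
  \<open>y\<close> itself.\<close>

lemma v_unimodular_insert_power:
  assumes unim: "v_unimodular (insert x B)" and x: "x \<in> base_ring"
  shows "v_unimodular (insert (x ^ n) B)"
  unfolding v_unimodular_def
proof (intro allI impI)
  fix y assume y: "\<forall>t\<in>insert (x ^ n) B. y * t \<in> base_ring"
  have pow: "x ^ j \<in> base_ring" for j
    by (induction j) (auto intro: base_ring_1 base_ring_mult[OF x])
  have "y * x ^ j \<in> base_ring" if "j \<le> n" for j
    using that
  proof (induction rule: inc_induct)
    case base
    then show ?case using y by simp
  next
    case (step j)
    show ?case
    proof (rule v_unimodularD[OF unim])
      fix t assume "t \<in> insert x B"
      then consider "t = x" | "t \<in> B" by blast
      then show "y * x ^ j * t \<in> base_ring"
      proof cases
        case 1
        then show ?thesis using step.IH by (simp add: mult_ac)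
      next
        case 2
        then have "y * t * x ^ j \<in> base_ring"
          using y pow base_ring_mult by blast
        then show ?thesis by (simp add: mult_ac)
      qed
    qed
  qed
  from this[of 0] show "y \<in> base_ring" by simp
qed

text \<open>The elements of \<open>A\<close> are replaced by their powers one at a time.
  \<open>B\<close> varies in the induction because it collects the powers already
  substituted.\<close>

lemma v_unimodular_powers:
  assumes "finite A" and "A \<subseteq> base_ring" and "v_unimodular (A \<union> B)"
  shows "v_unimodular ((\<lambda>x. x ^ n) ` A \<union> B)"
  using assms
proof (induction A arbitrary: B rule: finite_induct)
  case empty
  then show ?case by simp
next
  case (insert x A)
  have "v_unimodular (A \<union> insert (x ^ n) B)"
    using v_unimodular_insert_power[of x "A \<union> B" n] insert.prems by simp
  then show ?case
    using insert.IH[of "insert (x ^ n) B"] insert.prems by simp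
qed

section \<open>Finite data from t-invertibility\<close>

text \<open>An element of the product ideal involves only finitely many factors from
  \<open>M\<close>, and \<open>C\<close> collects them. Stating this as a test on multipliers
  \<open>y\<close> avoids explicit sums: the \<open>x\<close> that pass for some \<open>C\<close>
  form a submodule containing all products.\<close>

lemma ideal_mult_finite_witness:
  assumes "x \<in> ideal_mult (fract_module.span T) M"
  shows "\<exists>C. finite C \<and> C \<subseteq> M \<and>
    (\<forall>y. (\<forall>c\<in>C. \<forall>t\<in>T. y * (t * c) \<in> base_ring) \<longrightarrow> y * x \<in> base_ring)"
    (is "?P x")
proof -
  have "{u * c | u c. u \<in> fract_module.span T \<and> c \<in> M} \<subseteq> {x. ?P x}"
  proof clarify
    fix u c assume u: "u \<in> fract_module.span T" and c: "c \<in> M"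
    have "y * (u * c) \<in> base_ring" if "\<forall>t\<in>T. y * (t * c) \<in> base_ring" for y
    proof -
      have "y * c * u \<in> base_ring"
        by (rule mult_span_in_base_ring[OF u]) (use that in \<open>auto simp: mult_ac\<close>)
      then show ?thesis by (simp add: mult_ac)
    qed
    with c show "?P (u * c)"
      by (intro exI[of _ "{c}"]) auto
  qed
  moreover have "fract_module.subspace {x. ?P x}"
  proof (rule fract_module.subspaceI; unfold mem_Collect_eq)
    show "?P 0"
      by (intro exI[of _ "{}"]) (simp add: base_ring_0)
  next
    fix u v assume "?P u" "?P v"
    then obtain C C' where "finite C" "C \<subseteq> M" "finite C'" "C' \<subseteq> M"
      and "\<And>y. (\<forall>c\<in>C. \<forall>t\<in>T. y * (t * c) \<in> base_ring) \<Longrightarrow> y * u \<in> base_ring"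
      and "\<And>y. (\<forall>c\<in>C'. \<forall>t\<in>T. y * (t * c) \<in> base_ring) \<Longrightarrow> y * v \<in> base_ring"
      by auto
    then show "?P (u + v)"
      by (intro exI[of _ "C \<union> C'"]) (simp add: distrib_left base_ring_add)
  next
    fix r u assume "?P u"
    then obtain C where C: "finite C" "C \<subseteq> M"
      and *: "\<And>y. (\<forall>c\<in>C. \<forall>t\<in>T. y * (t * c) \<in> base_ring) \<Longrightarrow> y * u \<in> base_ring"
      by auto
    have "y * (to_fract r * u) \<in> base_ring"
      if "\<forall>c\<in>C. \<forall>t\<in>T. y * (t * c) \<in> base_ring" for y
      using base_ring_mult[of "to_fract r", OF _ *[OF that]] by (simp add: mult_ac)
    with C show "?P (to_fract r * u)"
      by (intro exI[of _ C]) simp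
  qed
  ultimately have "ideal_mult (fract_module.span T) M \<subseteq> {x. ?P x}"
    unfolding ideal_mult_def by (rule fract_module.span_minimal)
  with assms show ?thesis
    by (drule_tac subsetD) simp_all
qed

text \<open>Since 1 is in the t-closure, it is in the v-closure of some finitely generated
  \<open>J\<close> inside the product. The finite witnesses of the generators of \<open>J\<close>
  are united.\<close>

lemma t_invertible_finite_witness:
  assumes "t_closure (ideal_mult (fract_module.span T) M) = base_ring"
  obtains C where "finite C" "C \<subseteq> M" "v_unimodular {t * c | t c. t \<in> T \<and> c \<in> C}"
proof -
  have "1 \<in> t_closure (ideal_mult (fract_module.span T) M)"
    using assms base_ring_1 by simp
  then obtain J where J: "J \<subseteq> ideal_mult (fract_module.span T) M"
    and J_fg: "fg_fractional_ideal J" and J_v: "1 \<in> v_closure J"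
    unfolding t_closure_def by blast
  from J_fg obtain S where S: "finite S" "J = fract_module.span S"
    unfolding fg_fractional_ideal_def by blast
  have "\<forall>s\<in>S. \<exists>C. finite C \<and> C \<subseteq> M \<and>
    (\<forall>y. (\<forall>c\<in>C. \<forall>t\<in>T. y * (t * c) \<in> base_ring) \<longrightarrow> y * s \<in> base_ring)"
    using J S(2) fract_module.span_base by (blast intro: ideal_mult_finite_witness)
  then obtain F where F: "\<And>s. s \<in> S \<Longrightarrow> finite (F s) \<and> F s \<subseteq> M \<and>
    (\<forall>y. (\<forall>c\<in>F s. \<forall>t\<in>T. y * (t * c) \<in> base_ring) \<longrightarrow> y * s \<in> base_ring)"
    by metis
  show thesis
  proof (rule that[of "\<Union> (F ` S)"])
    show "finite (\<Union> (F ` S))" "\<Union> (F ` S) \<subseteq> M"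
      using F S(1) by blast+
    show "v_unimodular {t * c | t c. t \<in> T \<and> c \<in> \<Union> (F ` S)}"
      unfolding v_unimodular_def
    proof (intro allI impI)
      fix y assume "\<forall>x\<in>{t * c | t c. t \<in> T \<and> c \<in> \<Union> (F ` S)}. y * x \<in> base_ring"
      then have "y * s \<in> base_ring" if "s \<in> S" for s
        using F[OF that] that by blast
      then have "y \<in> ideal_inverse J"
        unfolding ideal_inverse_def S(2) by (blast intro: mult_span_in_base_ring)
      \<comment> \<open>As 1 is in the v-closure of \<open>J\<close>, the product
        \<open>1 * y\<close> is in \<open>D\<close>.\<close>
      with J_v show "y \<in> base_ring"
        by (auto simp: v_closure_def ideal_inverse_def)
    qed
  qed
qed

section \<open>Complete integral closure and the Archimedean property\<close>

lemma completely_integrally_closed_imp_archimedean: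
  assumes "completely_integrally_closed TYPE('a :: idom)"
  shows "archimedean_domain TYPE('a)"
  unfolding archimedean_domain_def
proof (intro allI impI)
  fix x :: 'a assume x: "\<not> x dvd 1"
  have "y = 0" if y: "y \<in> (\<Inter>n\<in>{1..}. ideal_gen {x ^ n})" for y
  proof (rule ccontr)
    assume "y \<noteq> 0"
    from y have "y \<in> ideal_gen {x ^ 1}"
      by blast
    then obtain r where r: "y = to_fract r"
      by (auto simp: ideal_gen_def fract_module.span_singleton simp flip: to_fract_mult)
    with \<open>y \<noteq> 0\<close> have "r \<noteq> 0" by auto
    have dvd: "x ^ n dvd r" if "n \<ge> 1" for n
      using y that by (auto simp: r to_fract_in_ideal_gen_singleton_iff)
    \<comment> \<open>This makes \<open>inverse (to_fract x)\<close> a genuine inverse, not the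
      default value 0.\<close>
    from dvd[of 1] \<open>r \<noteq> 0\<close> have "x \<noteq> 0" by auto
    have "to_fract r * inverse (to_fract x) ^ n \<in> base_ring" if "n \<ge> 1" for n
    proof -
      from dvd[OF that] obtain q where "r = x ^ n * q" ..
      with \<open>x \<noteq> 0\<close> have "to_fract r * inverse (to_fract x) ^ n = to_fract q"
        by (simp add: to_fract_power power_inverse field_simps)
      then show ?thesis by simp
    qed
    with assms \<open>r \<noteq> 0\<close> have "inverse (to_fract x) \<in> base_ring"
      unfolding completely_integrally_closed_def by blast
    then obtain q where "inverse (to_fract x) = to_fract q" by blast
    with \<open>x \<noteq> 0\<close> have "to_fract (x * q) = to_fract 1"
      by (metis right_inverse to_fract_1 to_fract_eq_0_iff to_fract_mult)
    then have "x * q = 1" by (simp only: to_fract_eq_iff)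
    with x show False by (metis dvd_triv_left)
  qed
  moreover have "0 \<in> (\<Inter>n\<in>{1..}. ideal_gen {x ^ n})"
    by (simp add: ideal_gen_def fract_module.span_zero)
  ultimately show "(\<Inter>n\<in>{1..}. ideal_gen {x ^ n}) = {0}"
    by blast
qed

theorem proposition2p9:
  assumes "pvmd TYPE('a :: idom)"
    and "\<And>as :: 'a list. as \<noteq> [] \<Longrightarrow> \<forall>a\<in>set as. a \<noteq> 0 \<Longrightarrow>
      v_closure (ideal_gen (set as)) \<noteq> base_ring \<Longrightarrow>
      \<exists>k::nat. k \<ge> 1 \<and> (\<exists>d. \<not> d dvd 1 \<and> ideal_gen ((\<lambda>a. a ^ k) ` set as) \<subseteq> ideal_gen {d})"
  shows "completely_integrally_closed TYPE('a) \<longleftrightarrow> archimedean_domain TYPE('a)"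
proof
  assume "completely_integrally_closed TYPE('a)"
  then show "archimedean_domain TYPE('a)"
    by (rule completely_integrally_closed_imp_archimedean)
next
  assume arch: "archimedean_domain TYPE('a)"
  show "completely_integrally_closed TYPE('a)"
    unfolding completely_integrally_closed_def
  proof (intro allI impI, elim conjE)
    fix z :: "'a fract" and r :: 'a
    assume r: "r \<noteq> 0" and rz: "\<forall>n\<ge>1. to_fract r * z ^ n \<in> base_ring"
    show "z \<in> base_ring"
    proof (rule ccontr)
      assume z: "z \<notin> base_ring"
      obtain a b where "z = Fract a b" and b: "b \<noteq> 0"
        by (cases z) auto
      then have zab: "z * to_fract b = to_fract a"
        by (simp add: Fract_conv_to_fract)
      define T where "T = {to_fract a, to_fract b}"
      let ?I = "fract_module.span T"
      have "?I \<noteq> {0}"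
        using fract_module.span_base[of "to_fract b" T] b by (auto simp: T_def)
      moreover have "?I \<subseteq> base_ring"
        using mult_span_in_base_ring[of _ T 1] by (auto simp: T_def)
      moreover have "fg_fractional_ideal ?I"
        by (rule fg_fractional_ideal_span) (auto simp: T_def)
      ultimately have "t_closure (ideal_mult ?I (ideal_inverse ?I)) = base_ring"
        using assms(1) by (auto simp: pvmd_def)
      then obtain C where C: "finite C" "C \<subseteq> ideal_inverse ?I"
        and unim: "v_unimodular {t * c | t c. t \<in> T \<and> c \<in> C}"
        by (rule t_invertible_finite_witness)
      define A where "A = {t * c | t c. t \<in> T \<and> c \<in> C}"
      have A_base: "A \<subseteq> base_ring"
      proof
        fix x assume "x \<in> A"
        then obtain t c where "t \<in> ?I" "c \<in> C" "x = c * t"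
          using fract_module.span_base[of _ T] by (auto simp: A_def) (metis mult.commute)
        with C(2) show "x \<in> base_ring"
          by (auto simp: ideal_inverse_def)
      qed
      have "A = (\<lambda>(t, c). t * c) ` (T \<times> C)"
        by (auto simp: A_def)
      then have "finite A"
        using C(1) by (simp add: T_def)
      \<comment> \<open>The elements \<open>b * c\<close> are pulled back to \<open>D\<close>. Zeros
        are dropped, since the divisibility hypothesis speaks of nonzero elements only.\<close>
      define B where "B = {x. x \<noteq> 0 \<and> (\<exists>c\<in>C. to_fract x = to_fract b * c)}"
      have "to_fract ` B \<subseteq> A"
        by (auto simp: A_def B_def T_def)
      then have "finite B"
        using \<open>finite A\<close> by (metis finite_imageD finite_subset inj_onI to_fract_eq_iff)
      then obtain as where as: "set as = B"
        using finite_list by blast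
      have B_ex: "\<exists>x\<in>B. to_fract x = to_fract b * c" if "c \<in> C" "c \<noteq> 0" for c
      proof -
        have "to_fract b * c \<in> base_ring"
          using that A_base by (auto simp: A_def T_def)
        then obtain x where "to_fract x = to_fract b * c" by (metis imageE)
        moreover from this have "x \<noteq> 0" using that b by auto
        ultimately show ?thesis using that by (auto simp: B_def)
      qed
      \<comment> \<open>Otherwise \<open>A\<close> has no nonzero element, and unimodularity would
        put \<open>z\<close> in \<open>D\<close>.\<close>
      have "B \<noteq> {}"
      proof
        assume "B = {}"
        then have "\<forall>c\<in>C. c = 0" using B_ex by blast
        then have "z * x \<in> base_ring" if "x \<in> A" for x
          using that base_ring_0 by (auto simp: A_def)
        with unim have "z \<in> base_ring"
          unfolding A_def[symmetric] by (rule v_unimodularD)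
        with z show False ..
      qed
      \<comment> \<open>On generators, \<open>z * (b * c) = a * c\<close>, which lies in
        \<open>A\<close> and hence in \<open>D\<close>.\<close>
      have "z \<in> ideal_inverse (ideal_gen B)"
        unfolding ideal_inverse_def ideal_gen_def mem_Collect_eq
      proof (intro ballI, erule mult_span_in_base_ring)
        fix s assume "s \<in> to_fract ` B"
        then obtain c where "c \<in> C" "s = to_fract b * c"
          by (auto simp: B_def)
        then have "z * s = to_fract a * c" "to_fract a * c \<in> A"
          using zab by (auto simp: A_def T_def mult.assoc[symmetric])
        with A_base show "z * s \<in> base_ring" by auto
      qed
      with z have "1 \<notin> v_closure (ideal_gen B)"
        by (auto simp: v_closure_def ideal_inverse_def)
      then have "v_closure (ideal_gen B) \<noteq> base_ring"
        using base_ring_1 by auto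
      moreover have "as \<noteq> []"
        using as \<open>B \<noteq> {}\<close> by force
      moreover have "\<forall>a\<in>B. a \<noteq> 0"
        unfolding B_def by blast
      ultimately have "\<exists>k\<ge>1. \<exists>d. \<not> d dvd 1 \<and>
          ideal_gen ((\<lambda>a. a ^ k) ` B) \<subseteq> ideal_gen {d}"
        using assms(2)[of as] unfolding as by simp
      then obtain k d where k: "k \<ge> 1" and d: "\<not> d dvd 1"
        and sub: "ideal_gen ((\<lambda>a. a ^ k) ` B) \<subseteq> ideal_gen {d}"
        by (elim exE conjE)
      have d_dvd: "d dvd x ^ k" if "x \<in> B" for x
      proof -
        have "to_fract (x ^ k) \<in> ideal_gen ((\<lambda>a. a ^ k) ` B)"
          unfolding ideal_gen_def using that by (intro fract_module.span_base) blast
        with sub show ?thesis by (auto simp: to_fract_in_ideal_gen_singleton_iff)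
      qed
      from \<open>B \<noteq> {}\<close> obtain x where "x \<in> B" by blast
      moreover from this have "x \<noteq> 0" by (simp add: B_def)
      ultimately have "d \<noteq> 0" using d_dvd[of x] by auto
      have "d ^ m dvd r" if m: "m \<ge> 1" for m
      proof -
        let ?y = "to_fract r / to_fract (d ^ m)"
        have b_pow: "\<exists>q. (to_fract b * c) ^ (k * m) = to_fract (d ^ m) * to_fract q"
          if "c \<in> C" for c
        \<comment> \<open>The case \<open>c = 0\<close> has no counterpart in \<open>B\<close>;
          there the power vanishes because \<open>k * m\<close> is positive.\<close>
        proof (cases "c = 0")
          case True
          then show ?thesis using k m by (intro exI[of _ 0]) simp
        next
          case False
          with B_ex that obtain x where x: "x \<in> B" "to_fract x = to_fract b * c" by blast
          from d_dvd[OF x(1)] have "d ^ m dvd x ^ (k * m)"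
            unfolding power_mult by (rule dvd_power_same)
          then obtain q where "x ^ (k * m) = d ^ m * q" ..
          then show ?thesis
            by (metis x(2) to_fract_mult to_fract_power)
        qed
        \<comment> \<open>To show that \<open>r / d ^ m\<close> is in \<open>D\<close>, it is enough
          to multiply it by the powers of the elements of \<open>A\<close>.\<close>
        have "v_unimodular ((\<lambda>x. x ^ (k * m)) ` A)"
          using v_unimodular_powers[OF \<open>finite A\<close> A_base, of "{}" "k * m"] unim
          by (simp add: A_def)
        then have "?y \<in> base_ring"
        proof (rule v_unimodularD)
          fix x assume "x \<in> (\<lambda>x. x ^ (k * m)) ` A"
          then obtain t c where t: "t \<in> T" and c: "c \<in> C" and x: "x = (t * c) ^ (k * m)"
            by (auto simp: A_def)
          from b_pow[OF c] obtain q
            where q: "(to_fract b * c) ^ (k * m) = to_fract (d ^ m) * to_fract q" ..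
          from t consider "t = to_fract a" | "t = to_fract b"
            by (auto simp: T_def)
          then show "?y * x \<in> base_ring"
          proof cases
            case 1
            \<comment> \<open>Writing \<open>a * c\<close> as \<open>z * (b * c)\<close> lets
              \<open>d ^ m\<close> cancel against the power of \<open>b * c\<close>, while
              \<open>r\<close> absorbs the power of \<open>z\<close>.\<close>
            then have "x = z ^ (k * m) * (to_fract b * c) ^ (k * m)"
              using zab by (simp add: x mult.assoc flip: power_mult_distrib)
                (simp add: mult.assoc[symmetric])
            then have "?y * x = to_fract r * z ^ (k * m) * to_fract q"
              using \<open>d \<noteq> 0\<close> by (simp add: q to_fract_power)
            moreover have "to_fract r * z ^ (k * m) \<in> base_ring"
              using rz k m by simp
            ultimately show ?thesis
              by (simp add: base_ring_mult)
          next
            case 2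
            then have "?y * x = to_fract r * to_fract q"
              using \<open>d \<noteq> 0\<close> by (simp add: x q to_fract_power)
            then show ?thesis by (simp add: base_ring_mult)
          qed
        qed
        then obtain q where "?y = to_fract q" by blast
        then have "to_fract r = to_fract (d ^ m * q)"
          using \<open>d \<noteq> 0\<close> by (simp add: to_fract_power field_simps)
        then have "r = d ^ m * q" by (simp only: to_fract_eq_iff)
        then show ?thesis by simp
      qed
      then have "to_fract r \<in> (\<Inter>n\<in>{1..}. ideal_gen {d ^ n})"
        by (auto simp: to_fract_in_ideal_gen_singleton_iff)
      with arch d have "to_fract r = 0"
        unfolding archimedean_domain_def by blast
      with r show False by simp
    qed
  qed
qed

end
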